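(* Let $(\mathrm{L},H,G)$ be the $4$-dimensional almost hypercomplex pseudo-Hermitian manifold on the Lie group $\mathrm{L}$ described in the context (with real parameters $(\lambda_1,\lambda_2,\lambda_3,\lambda_4)\neq(0,0,0,0)$). Then: (i) if $(\mathrm{L},H,G)$ is isotropic Kählerian with respect to some $J_\alpha$ ($\alpha\in\{1,2,3\}$), then it is isotropic hyper-Kählerian; (ii) $(\mathrm{L},H,G)$ is isotropic hyper-Kählerian if and only if $\lambda_1^2+\lambda_2^2-\lambda_3^2-\lambda_4^2=0$; (iii) $(\mathrm{L},H,G)$ is isotropic hyper-Kählerian if and only if it has zero scalar curvature $\tau$.
   Context: The Lie group. $\mathrm{L}$ is a connected Lie group whose Lie algebra has a global basis of left-invariant vector fields $\{X_1,X_2,X_3,X_4\}$ with $$[X_1,X_3]=\lambda_2X_2+\lambda_4X_4,\quad [X_2,X_4]=\lambda_1X_1+\lambda_3X_3,\quad [X_2,X_3]=-\lambda_2X_1-\lambda_3X_4,$$ $$[X_3,X_4]=-\lambda_4X_1+\lambda_3X_2,\quad [X_4,X_1]=\lambda_1X_2+\lambda_4X_3,\quad [X_2,X_1]=-\lambda_2X_3+\lambda_1X_4,$$ where $\lambda_i\in\mathbb{R}$ and $(\lambda_1,\lambda_2,\lambda_3,\lambda_4)\neq(0,0,0,0)$. The metric. $g$ is the left-invariant pseudo-Riemannian metric with $g(X_1,X_1)=g(X_2,X_2)=-g(X_3,X_3)=-g(X_4,X_4)=1$ and $g(X_i,X_j)=0$ for $i\ne j$; it satisfies $g([X_i,X_j],X_k)+g([X_i,X_k],X_j)=0$.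 The structure $H=(J_1,J_2,J_3)$ (left-invariant almost complex structures). $J_1X_1=X_2,\ J_1X_2=-X_1,\ J_1X_3=-X_4,\ J_1X_4=X_3$; $J_2X_1=X_3,\ J_2X_2=X_4,\ J_2X_3=-X_1,\ J_2X_4=-X_2$; $J_3=J_1J_2$. One has $g(J_1x,J_1y)=-g(J_2x,J_2y)=-g(J_3x,J_3y)=g(x,y)$. $G=(g,\Phi,g_2,g_3)$ with $\Phi(x,y)=g(J_1x,y)$, $g_2(x,y)=g(J_2x,y)$, $g_3(x,y)=g(J_3x,y)$. Definitions. Let $\nabla$ be the Levi-Civita connection of $g$ and $\tau$ the scalar curvature of $g$. For $\alpha=1,2,3$ put $$\|\nabla J_\alpha\|^2=g^{ij}g^{kl}g\big((\nabla_{e_i}J_\alpha)e_k,(\nabla_{e_j}J_\alpha)e_l\big),$$ where $\{e_i\}$ is an arbitrary basis of the tangent space, $(g^{ij})$ is the inverse of the matrix $(g(e_i,e_j))$, and repeated indices are summed (this quantity may be zero or negative since $g$ is indefinite). The manifold is isotropic Kählerian with respect to $J_\alpha$ if $\|\nabla J_\alpha\|^2=0$; it is isotropic hyper-Kählerian if it is isotropic Kählerian with respect to every $J_\alpha$, $\alpha=1,2,3$. *)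

theory Defs
  imports "HOL-Analysis.Analysis" "HOL-Algebra.Group"
begin

text \<open>
  A manifold is the whole of a type \<open>'g\<close> together with an atlas of charts into \<open>real ^ 'n\<close>.
  A tangent vector at \<open>p\<close> is a derivation at \<open>p\<close> of the algebra of smooth functions on the
  manifold. To make equality of tangent vectors meaningful, a tangent vector takes the value 0
  on functions that are not smooth.
\<close>

type_synonym ('g, 'n) chart = "'g set \<times> ('g \<Rightarrow> real ^ 'n)"
type_synonym 'g tvec = "('g \<Rightarrow> real) \<Rightarrow> real"
type_synonym 'g vfield = "'g \<Rightarrow> 'g tvec"
type_synonym 'g tensor2 = "'g \<Rightarrow> 'g tvec \<Rightarrow> 'g tvec \<Rightarrow> real"
type_synonym 'g endofield = "'g \<Rightarrow> 'g tvec \<Rightarrow> 'g tvec"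
type_synonym 'g connection = "'g vfield \<Rightarrow> 'g vfield \<Rightarrow> 'g vfield"

section \<open>Smooth manifolds and Lie groups\<close>

text \<open>Only used on open sets \<open>S\<close>.\<close>

primrec Ck_on :: "nat \<Rightarrow> ('a::real_normed_vector \<Rightarrow> 'b::real_normed_vector) \<Rightarrow> 'a set \<Rightarrow> bool"
  where
    "Ck_on 0 f S \<longleftrightarrow> continuous_on S f"
  | "Ck_on (Suc k) f S \<longleftrightarrow>
       (\<forall>x\<in>S. f differentiable (at x)) \<and> (\<forall>v. Ck_on k (\<lambda>x. frechet_derivative f (at x) v) S)"

definition smooth_on :: "('a::real_normed_vector \<Rightarrow> 'b::real_normed_vector) \<Rightarrow> 'a set \<Rightarrow> bool"
  where "smooth_on f S \<longleftrightarrow> (\<forall>k. Ck_on k f S)"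

definition smooth_atlas :: "('g::topological_space, 'n::finite) chart set \<Rightarrow> bool"
  where "smooth_atlas A \<longleftrightarrow>
    (\<Union>(U, \<phi>)\<in>A. U) = UNIV \<and>
    (\<forall>(U, \<phi>)\<in>A. open U \<and> open (\<phi> ` U) \<and> homeomorphism U (\<phi> ` U) \<phi> (inv_into U \<phi>)) \<and>
    (\<forall>(U, \<phi>)\<in>A. \<forall>(V, \<psi>)\<in>A. smooth_on (\<lambda>x. \<psi> (inv_into U \<phi> x)) (\<phi> ` (U \<inter> V)))"

definition smooth_fun :: "('g::topological_space, 'n::finite) chart set \<Rightarrow> ('g \<Rightarrow> real) \<Rightarrow> bool"
  where "smooth_fun A f \<longleftrightarrow> (\<forall>(U, \<phi>)\<in>A. smooth_on (\<lambda>x. f (inv_into U \<phi> x)) (\<phi> ` U))"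

definition lie_group :: "'g::topological_space monoid \<Rightarrow> ('g, 'n::finite) chart set \<Rightarrow> bool"
  where "lie_group G A \<longleftrightarrow>
    group G \<and> carrier G = UNIV \<and> smooth_atlas A \<and>
    continuous_on UNIV (\<lambda>(a, b). a \<otimes>\<^bsub>G\<^esub> b) \<and>
    (\<forall>(U, \<phi>)\<in>A. \<forall>(V, \<psi>)\<in>A. \<forall>(W, \<theta>)\<in>A.
       smooth_on (\<lambda>(x, y). \<theta> (inv_into U \<phi> x \<otimes>\<^bsub>G\<^esub> inv_into V \<psi> y))
         {(\<phi> a, \<psi> b) |a b. a \<in> U \<and> b \<in> V \<and> a \<otimes>\<^bsub>G\<^esub> b \<in> W}) \<and>
    continuous_on UNIV (\<lambda>a. inv\<^bsub>G\<^esub> a) \<and>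
    (\<forall>(U, \<phi>)\<in>A. \<forall>(V, \<psi>)\<in>A.
       smooth_on (\<lambda>x. \<psi> (inv\<^bsub>G\<^esub> (inv_into U \<phi> x))) {\<phi> a |a. a \<in> U \<and> inv\<^bsub>G\<^esub> a \<in> V})"

section \<open>Tangent vectors and vector fields\<close>

definition tangent_space :: "('g::topological_space, 'n::finite) chart set \<Rightarrow> 'g \<Rightarrow> 'g tvec set"
  where "tangent_space A p = {v.
    (\<forall>f h. smooth_fun A f \<and> smooth_fun A h \<longrightarrow> v (\<lambda>q. f q + h q) = v f + v h) \<and>
    (\<forall>c f. smooth_fun A f \<longrightarrow> v (\<lambda>q. c * f q) = c * v f) \<and>
    (\<forall>f h. smooth_fun A f \<and> smooth_fun A h \<longrightarrow> v (\<lambda>q. f q * h q) = v f * h p + f p * v h) \<and>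
    (\<forall>f. \<not> smooth_fun A f \<longrightarrow> v f = 0)}"

definition tangent_basis ::
    "('g::topological_space, 'n::finite) chart set \<Rightarrow> 'g \<Rightarrow> ('n \<Rightarrow> 'g tvec) \<Rightarrow> bool"
  where "tangent_basis A p e \<longleftrightarrow>
    (\<forall>i. e i \<in> tangent_space A p) \<and>
    (\<forall>v\<in>tangent_space A p. \<exists>!c::real ^ 'n. v = (\<lambda>f. \<Sum>i\<in>UNIV. c $ i * e i f))"

definition vector_fields :: "('g::topological_space, 'n::finite) chart set \<Rightarrow> 'g vfield set"
  where "vector_fields A = {X.
    (\<forall>p. X p \<in> tangent_space A p) \<and> (\<forall>f. smooth_fun A f \<longrightarrow> smooth_fun A (\<lambda>p. X p f))}"

definition lie_bracket :: "'g vfield \<Rightarrow> 'g vfield \<Rightarrow> 'g vfield"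
  where "lie_bracket X Y = (\<lambda>p f. X p (\<lambda>q. Y q f) - Y p (\<lambda>q. X q f))"

text \<open>
  A basis of the tangent space at \<open>p\<close>, extended to smooth vector fields; away from \<open>p\<close> the fields
  need not be linearly independent. Expressions that are tensorial in the fields \<open>E i\<close>
  depend only on the basis at \<open>p\<close>, so quantifying over such \<open>E\<close> is quantifying over bases of the
  tangent space.
\<close>

definition basis_fields ::
    "('g::topological_space, 'n::finite) chart set \<Rightarrow> 'g \<Rightarrow> ('n \<Rightarrow> 'g vfield) \<Rightarrow> bool"
  where "basis_fields A p E \<longleftrightarrow>
    (\<forall>i. E i \<in> vector_fields A) \<and> tangent_basis A p (\<lambda>i. E i p)"

section \<open>Left-invariance\<close>

text \<open>The differential of \<open>h\<close>.\<close>

definition push_forward :: "('g \<Rightarrow> 'g) \<Rightarrow> 'g tvec \<Rightarrow> 'g tvec"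
  where "push_forward h v = (\<lambda>f. v (\<lambda>q. f (h q)))"

definition left_translation :: "'g monoid \<Rightarrow> 'g \<Rightarrow> 'g \<Rightarrow> 'g"
  where "left_translation G a = (\<lambda>q. a \<otimes>\<^bsub>G\<^esub> q)"

definition left_invariant_field :: "'g monoid \<Rightarrow> 'g vfield \<Rightarrow> bool"
  where "left_invariant_field G X \<longleftrightarrow>
    (\<forall>a p. X (a \<otimes>\<^bsub>G\<^esub> p) = push_forward (left_translation G a) (X p))"

definition left_invariant_tensor2 ::
    "'g::topological_space monoid \<Rightarrow> ('g, 'n::finite) chart set \<Rightarrow> 'g tensor2 \<Rightarrow> bool"
  where "left_invariant_tensor2 G A g \<longleftrightarrow>
    (\<forall>a p. \<forall>v\<in>tangent_space A p. \<forall>w\<in>tangent_space A p.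
       g (a \<otimes>\<^bsub>G\<^esub> p) (push_forward (left_translation G a) v) (push_forward (left_translation G a) w)
         = g p v w)"

definition left_invariant_endofield ::
    "'g::topological_space monoid \<Rightarrow> ('g, 'n::finite) chart set \<Rightarrow> 'g endofield \<Rightarrow> bool"
  where "left_invariant_endofield G A J \<longleftrightarrow>
    (\<forall>a p. \<forall>v\<in>tangent_space A p.
       J (a \<otimes>\<^bsub>G\<^esub> p) (push_forward (left_translation G a) v)
         = push_forward (left_translation G a) (J p v))"

section \<open>Metric, almost complex structures, Levi-Civita connection\<close>

definition pseudo_riemannian_metric ::
    "('g::topological_space, 'n::finite) chart set \<Rightarrow> 'g tensor2 \<Rightarrow> bool"
  where "pseudo_riemannian_metric A g \<longleftrightarrow>
    (\<forall>p. \<forall>u\<in>tangent_space A p. \<forall>v\<in>tangent_space A p. g p u v = g p v u) \<and>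
    (\<forall>p. \<forall>u\<in>tangent_space A p. \<forall>v\<in>tangent_space A p. \<forall>w\<in>tangent_space A p.
       g p (\<lambda>f. u f + v f) w = g p u w + g p v w) \<and>
    (\<forall>p. \<forall>u\<in>tangent_space A p. \<forall>v\<in>tangent_space A p. \<forall>c.
       g p (\<lambda>f. c * u f) v = c * g p u v) \<and>
    (\<forall>p. \<forall>u\<in>tangent_space A p. (\<forall>v\<in>tangent_space A p. g p u v = 0) \<longrightarrow> u = (\<lambda>f. 0)) \<and>
    (\<forall>X\<in>vector_fields A. \<forall>Y\<in>vector_fields A. smooth_fun A (\<lambda>p. g p (X p) (Y p)))"

definition almost_complex_structure ::
    "('g::topological_space, 'n::finite) chart set \<Rightarrow> 'g endofield \<Rightarrow> bool"
  where "almost_complex_structure A J \<longleftrightarrow>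
    (\<forall>p. \<forall>v\<in>tangent_space A p. J p v \<in> tangent_space A p) \<and>
    (\<forall>p. \<forall>u\<in>tangent_space A p. \<forall>v\<in>tangent_space A p.
       J p (\<lambda>f. u f + v f) = (\<lambda>f. J p u f + J p v f)) \<and>
    (\<forall>p. \<forall>v\<in>tangent_space A p. \<forall>c. J p (\<lambda>f. c * v f) = (\<lambda>f. c * J p v f)) \<and>
    (\<forall>X\<in>vector_fields A. (\<lambda>p. J p (X p)) \<in> vector_fields A) \<and>
    (\<forall>p. \<forall>v\<in>tangent_space A p. J p (J p v) = (\<lambda>f. - v f))"

definition affine_connection ::
    "('g::topological_space, 'n::finite) chart set \<Rightarrow> 'g connection \<Rightarrow> bool"
  where "affine_connection A D \<longleftrightarrow>
    (\<forall>X\<in>vector_fields A. \<forall>Y\<in>vector_fields A. D X Y \<in> vector_fields A) \<and>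
    (\<forall>X\<in>vector_fields A. \<forall>Y\<in>vector_fields A. \<forall>Z\<in>vector_fields A.
       D (\<lambda>p f. X p f + Y p f) Z = (\<lambda>p f. D X Z p f + D Y Z p f)) \<and>
    (\<forall>X\<in>vector_fields A. \<forall>Y\<in>vector_fields A. \<forall>h. smooth_fun A h \<longrightarrow>
       D (\<lambda>p f. h p * X p f) Y = (\<lambda>p f. h p * D X Y p f)) \<and>
    (\<forall>X\<in>vector_fields A. \<forall>Y\<in>vector_fields A. \<forall>Z\<in>vector_fields A.
       D X (\<lambda>p f. Y p f + Z p f) = (\<lambda>p f. D X Y p f + D X Z p f)) \<and>
    (\<forall>X\<in>vector_fields A. \<forall>Y\<in>vector_fields A. \<forall>h. smooth_fun A h \<longrightarrow>
       D X (\<lambda>p f. h p * Y p f) = (\<lambda>p f. X p h * Y p f + h p * D X Y p f))"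

definition levi_civita_connection ::
    "('g::topological_space, 'n::finite) chart set \<Rightarrow> 'g tensor2 \<Rightarrow> 'g connection \<Rightarrow> bool"
  where "levi_civita_connection A g D \<longleftrightarrow>
    affine_connection A D \<and>
    (\<forall>X\<in>vector_fields A. \<forall>Y\<in>vector_fields A.
       (\<lambda>p f. D X Y p f - D Y X p f) = lie_bracket X Y) \<and>
    (\<forall>X\<in>vector_fields A. \<forall>Y\<in>vector_fields A. \<forall>Z\<in>vector_fields A. \<forall>p.
       X p (\<lambda>q. g q (Y q) (Z q)) = g p (D X Y p) (Z p) + g p (Y p) (D X Z p))"

section \<open>Square norm of the derivative of an almost complex structure; scalar curvature\<close>

definition inverse_gram :: "'g tensor2 \<Rightarrow> ('n::finite \<Rightarrow> 'g vfield) \<Rightarrow> 'g \<Rightarrow> real ^ 'n ^ 'n"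
  where "inverse_gram g E p = matrix_inv (\<chi> i j. g p (E i p) (E j p))"

text \<open>\<open>(\<nabla>\<^sub>X J) Y = \<nabla>\<^sub>X (J Y) - J (\<nabla>\<^sub>X Y)\<close>\<close>

definition nabla_endo :: "'g connection \<Rightarrow> 'g endofield \<Rightarrow> 'g vfield \<Rightarrow> 'g vfield \<Rightarrow> 'g vfield"
  where "nabla_endo D J X Y = (\<lambda>p f. D X (\<lambda>q. J q (Y q)) p f - J p (D X Y p) f)"

definition nabla_norm_sq ::
    "'g tensor2 \<Rightarrow> 'g connection \<Rightarrow> 'g endofield \<Rightarrow> ('n::finite \<Rightarrow> 'g vfield) \<Rightarrow> 'g \<Rightarrow> real"
  where "nabla_norm_sq g D J E p =
    (\<Sum>i\<in>UNIV. \<Sum>j\<in>UNIV. \<Sum>k\<in>UNIV. \<Sum>l\<in>UNIV.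
       inverse_gram g E p $ i $ j * inverse_gram g E p $ k $ l *
       g p (nabla_endo D J (E i) (E k) p) (nabla_endo D J (E j) (E l) p))"

definition curvature :: "'g connection \<Rightarrow> 'g vfield \<Rightarrow> 'g vfield \<Rightarrow> 'g vfield \<Rightarrow> 'g vfield"
  where "curvature D X Y Z =
    (\<lambda>p f. D X (D Y Z) p f - D Y (D X Z) p f - D (lie_bracket X Y) Z p f)"

definition ricci ::
    "'g tensor2 \<Rightarrow> 'g connection \<Rightarrow> ('n::finite \<Rightarrow> 'g vfield) \<Rightarrow> 'g vfield \<Rightarrow> 'g vfield \<Rightarrow> 'g \<Rightarrow> real"
  where "ricci g D E Y Z p =
    (\<Sum>i\<in>UNIV. \<Sum>j\<in>UNIV. inverse_gram g E p $ i $ j * g p (curvature D (E i) Y Z p) (E j p))"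

definition scalar_curvature ::
    "'g tensor2 \<Rightarrow> 'g connection \<Rightarrow> ('n::finite \<Rightarrow> 'g vfield) \<Rightarrow> 'g \<Rightarrow> real"
  where "scalar_curvature g D E p =
    (\<Sum>i\<in>UNIV. \<Sum>j\<in>UNIV. inverse_gram g E p $ i $ j * ricci g D E (E i) (E j) p)"

definition isotropic_kaehlerian ::
    "('g::topological_space, 'n::finite) chart set \<Rightarrow> 'g tensor2 \<Rightarrow> 'g connection \<Rightarrow> 'g endofield \<Rightarrow> bool"
  where "isotropic_kaehlerian A g D J \<longleftrightarrow>
    (\<forall>p. \<forall>E::'n \<Rightarrow> 'g vfield. basis_fields A p E \<longrightarrow> nabla_norm_sq g D J E p = 0)"

definition isotropic_hyper_kaehlerian ::
    "('g::topological_space, 'n::finite) chart set \<Rightarrow> 'g tensor2 \<Rightarrow> 'g connection \<Rightarrow>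
     (3 \<Rightarrow> 'g endofield) \<Rightarrow> bool"
  where "isotropic_hyper_kaehlerian A g D J \<longleftrightarrow> (\<forall>\<alpha>. isotropic_kaehlerian A g D (J \<alpha>))"

definition zero_scalar_curvature ::
    "('g::topological_space, 'n::finite) chart set \<Rightarrow> 'g tensor2 \<Rightarrow> 'g connection \<Rightarrow> bool"
  where "zero_scalar_curvature A g D \<longleftrightarrow>
    (\<forall>p. \<forall>E::'n \<Rightarrow> 'g vfield. basis_fields A p E \<longrightarrow> scalar_curvature g D E p = 0)"

end

theory Submission
  imports Defs
begin

text \<open>
  The metric is bi-invariant on the Lie algebra, so Koszul's formula gives
  \<open>\<nabla>\<^bsub>X\<^sub>i\<^esub> X\<^sub>j = [X\<^sub>i, X\<^sub>j] / 2\<close>. Both \<open>\<parallel>\<nabla>J\<^sub>\<alpha>\<parallel>\<^sup>2\<close> and \<open>\<tau>\<close> are metric traces of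
  \<open>C\<^sup>\<infinity>\<close>-multilinear expressions, hence can be computed in the frame \<open>X\<close>; they become quadratic forms
  in the structure constants. With \<open>q = \<lambda>\<^sub>1\<^sup>2 + \<lambda>\<^sub>2\<^sup>2 - \<lambda>\<^sub>3\<^sup>2 - \<lambda>\<^sub>4\<^sup>2\<close> one finds
  \<open>\<parallel>\<nabla>J\<^sub>1\<parallel>\<^sup>2 = -2 q\<close>, \<open>\<parallel>\<nabla>J\<^sub>2\<parallel>\<^sup>2 = \<parallel>\<nabla>J\<^sub>3\<parallel>\<^sup>2 = 4 q\<close> and \<open>\<tau> = -3 q / 2\<close>, so all four quantities
  vanish exactly when \<open>q = 0\<close>.
\<close>

section \<open>Smooth functions and vector fields\<close>

text \<open>Since \<open>S\<close> is open, two functions agreeing on \<open>S\<close> agree near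
  each of its points and so have the same derivative there. This lets derivative formulas valid only
  on \<open>S\<close> be substituted into \<open>Ck_on\<close>.\<close>

lemma Ck_on_cong:
  assumes "open S" "\<And>x. x \<in> S \<Longrightarrow> f x = h x" "Ck_on k f S"
  shows "Ck_on k h S"
  using assms(2,3)
proof (induction k arbitrary: f h)
  case 0
  then show ?case
    using continuous_on_cong[of S S f h] by simp
next
  case (Suc k)
  have *: "(h has_derivative frechet_derivative f (at x)) (at x)" if "x \<in> S" for x
    using has_derivative_transform_within_open[OF _ assms(1) that Suc.prems(1)] Suc.prems(2) that
    by (simp add: frechet_derivative_works)
  then have "frechet_derivative h (at x) = frechet_derivative f (at x)" if "x \<in> S" for x
    using frechet_derivative_at that by metis
  then have "Ck_on k (\<lambda>x. frechet_derivative h (at x) v) S" for v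
    using Suc.IH[of "\<lambda>x. frechet_derivative f (at x) v" "\<lambda>x. frechet_derivative h (at x) v"]
      Suc.prems(2) by simp
  then show ?case
    using * by (auto simp: differentiable_def)
qed

text \<open>Needed for the product rule, where each derivative is multiplied by an undifferentiated
  factor.\<close>

lemma Ck_on_Suc_imp_Ck_on: "Ck_on (Suc k) f S \<Longrightarrow> Ck_on k f S"
proof (induction k arbitrary: f)
  case 0
  then show ?case
    by (auto intro!: continuous_at_imp_continuous_on differentiable_imp_continuous_within)
next
  case (Suc k)
  then show ?case
    by (metis Ck_on.simps(2))
qed

lemma Ck_on_const: "Ck_on k (\<lambda>x. c) S"
  by (induction k arbitrary: c) auto

lemma Ck_on_add:
  assumes "open S" "Ck_on k f S" "Ck_on k h S"
  shows "Ck_on k (\<lambda>x. f x + h x) S"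
  using assms(2,3)
proof (induction k arbitrary: f h)
  case 0
  then show ?case
    by (auto intro: continuous_on_add)
next
  case (Suc k)
  have d: "f differentiable at x" "h differentiable at x" if "x \<in> S" for x
    using Suc.prems that by auto
  have "frechet_derivative (\<lambda>x. f x + h x) (at x) v
      = frechet_derivative f (at x) v + frechet_derivative h (at x) v" if "x \<in> S" for x v
    using frechet_derivative_at[OF has_derivative_add
        [OF d[OF that, unfolded frechet_derivative_works]]] by metis
  moreover have "Ck_on k (\<lambda>x. frechet_derivative f (at x) v + frechet_derivative h (at x) v) S" for v
    using Suc.IH Suc.prems by simp
  ultimately have "Ck_on k (\<lambda>x. frechet_derivative (\<lambda>x. f x + h x) (at x) v) S" for v
    using Ck_on_cong[OF assms(1)] by (smt (verit, best))
  then show ?case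
    using d by (auto intro: differentiable_add)
qed

lemma Ck_on_mult:
  fixes f h :: "'a::real_normed_vector \<Rightarrow> real"
  assumes "open S" "Ck_on k f S" "Ck_on k h S"
  shows "Ck_on k (\<lambda>x. f x * h x) S"
  using assms(2,3)
proof (induction k arbitrary: f h)
  case 0
  then show ?case
    by (auto intro: continuous_on_mult)
next
  case (Suc k)
  have d: "f differentiable at x" "h differentiable at x" if "x \<in> S" for x
    using Suc.prems that by auto
  have "frechet_derivative (\<lambda>x. f x * h x) (at x) v
      = f x * frechet_derivative h (at x) v + frechet_derivative f (at x) v * h x" if "x \<in> S" for x v
    using frechet_derivative_at[OF has_derivative_mult
        [OF d[OF that, unfolded frechet_derivative_works]]] by metis
  moreover have "Ck_on k (\<lambda>x. f x * frechet_derivative h (at x) v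
      + frechet_derivative f (at x) v * h x) S" for v
    using Suc.IH Suc.prems Suc.prems[THEN Ck_on_Suc_imp_Ck_on] by (intro Ck_on_add assms(1)) auto
  ultimately have "Ck_on k (\<lambda>x. frechet_derivative (\<lambda>x. f x * h x) (at x) v) S" for v
    using Ck_on_cong[OF assms(1)] by (smt (verit, best))
  then show ?case
    using d by (auto intro: differentiable_mult)
qed

section \<open>The ring of smooth functions and the module of vector fields over it\<close>

locale smooth_manifold =
  fixes A :: "('g::topological_space, 'n::finite) chart set"
  assumes atlas: "smooth_atlas A"
begin

lemma open_chart_image: "(U, \<phi>) \<in> A \<Longrightarrow> open (\<phi> ` U)"
  using atlas by (auto simp: smooth_atlas_def)

lemma smooth_fun_const: "smooth_fun A (\<lambda>p. c)"
  by (simp add: smooth_fun_def smooth_on_def Ck_on_const)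

lemma smooth_fun_add: "smooth_fun A f \<Longrightarrow> smooth_fun A h \<Longrightarrow> smooth_fun A (\<lambda>p. f p + h p)"
  unfolding smooth_fun_def smooth_on_def using Ck_on_add[OF open_chart_image] by fastforce

lemma smooth_fun_mult: "smooth_fun A f \<Longrightarrow> smooth_fun A h \<Longrightarrow> smooth_fun A (\<lambda>p. f p * h p)"
  unfolding smooth_fun_def smooth_on_def using Ck_on_mult[OF open_chart_image] by fastforce

lemma tangent_space_add:
  "v \<in> tangent_space A p \<Longrightarrow> w \<in> tangent_space A p \<Longrightarrow> (\<lambda>f. v f + w f) \<in> tangent_space A p"
  by (auto simp: tangent_space_def algebra_simps)

lemma tangent_space_scale: "v \<in> tangent_space A p \<Longrightarrow> (\<lambda>f. c * v f) \<in> tangent_space A p"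
  by (auto simp: tangent_space_def algebra_simps)

text \<open>The Leibniz rule for \<open>1 * 1\<close> gives \<open>v 1 = 2 * v 1\<close>, so
  \<open>v\<close> kills 1, and homogeneity extends this to all constants.\<close>

lemma tangent_vector_const:
  assumes "v \<in> tangent_space A p"
  shows "v (\<lambda>q. c) = 0"
proof -
  have "v (\<lambda>q. 1 * 1) = v (\<lambda>q. 1) * 1 + 1 * v (\<lambda>q. 1)"
    using assms smooth_fun_const[of 1] unfolding tangent_space_def by blast
  moreover have "v (\<lambda>q. c * 1) = c * v (\<lambda>q. 1)"
    using assms smooth_fun_const[of 1] unfolding tangent_space_def by blast
  ultimately show ?thesis
    by simp
qed

lemma vector_field_tangent: "Y \<in> vector_fields A \<Longrightarrow> Y p \<in> tangent_space A p"
  by (simp add: vector_fields_def)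

lemma vector_field_smooth: "Y \<in> vector_fields A \<Longrightarrow> smooth_fun A f \<Longrightarrow> smooth_fun A (\<lambda>p. Y p f)"
  by (simp add: vector_fields_def)

lemma vector_fields_add:
  "Y \<in> vector_fields A \<Longrightarrow> Z \<in> vector_fields A \<Longrightarrow> (\<lambda>p f. Y p f + Z p f) \<in> vector_fields A"
  by (auto simp: vector_fields_def intro: tangent_space_add smooth_fun_add)

lemma vector_fields_scale:
  "Y \<in> vector_fields A \<Longrightarrow> smooth_fun A h \<Longrightarrow> (\<lambda>p f. h p * Y p f) \<in> vector_fields A"
  by (auto simp: vector_fields_def intro: tangent_space_scale smooth_fun_mult)

lemma vector_fields_cmult:
  "Y \<in> vector_fields A \<Longrightarrow> (\<lambda>p f. c * Y p f) \<in> vector_fields A"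
  using vector_fields_scale smooth_fun_const by blast

lemma vector_fields_zero: "(\<lambda>p f. 0) \<in> vector_fields A"
  by (auto simp: vector_fields_def tangent_space_def smooth_fun_const)

lemma vector_fields_sum:
  "finite I \<Longrightarrow> (\<And>i. i \<in> I \<Longrightarrow> Y i \<in> vector_fields A)
    \<Longrightarrow> (\<lambda>p f. \<Sum>i\<in>I. Y i p f) \<in> vector_fields A"
  by (induction I rule: finite_induct) (auto intro: vector_fields_zero vector_fields_add)

lemma additive_sum:
  fixes B :: "'g vfield \<Rightarrow> real"
  assumes add: "\<And>Y Z. Y \<in> vector_fields A \<Longrightarrow> Z \<in> vector_fields A
      \<Longrightarrow> B (\<lambda>p f. Y p f + Z p f) = B Y + B Z"
    and "finite I" "\<And>i. i \<in> I \<Longrightarrow> Y i \<in> vector_fields A"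
  shows "B (\<lambda>p f. \<Sum>i\<in>I. Y i p f) = (\<Sum>i\<in>I. B (Y i))"
  using assms(2,3)
proof (induction I rule: finite_induct)
  case empty
  show ?case
    \<comment> \<open>Additivity alone gives \<open>B 0 = B 0 + B 0\<close>, hence
      \<open>B 0 = 0\<close>.\<close>
    using add[OF vector_fields_zero vector_fields_zero] by simp
next
  case (insert i I)
  then show ?case
    using add[of "Y i" "\<lambda>p f. \<Sum>i\<in>I. Y i p f"] vector_fields_sum[of I Y] by simp
qed

text \<open>Linearity over smooth functions, evaluated at the single point \<open>p\<close>.
  Together with a global frame it expresses \<open>B\<close> through its values on the frame,
  without any localisation argument.\<close>

definition tensorial_at :: "'g \<Rightarrow> ('g vfield \<Rightarrow> real) \<Rightarrow> bool"
  where "tensorial_at p B \<longleftrightarrow>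
    (\<forall>Y\<in>vector_fields A. \<forall>Z\<in>vector_fields A. B (\<lambda>q f. Y q f + Z q f) = B Y + B Z) \<and>
    (\<forall>Y\<in>vector_fields A. \<forall>h. smooth_fun A h \<longrightarrow> B (\<lambda>q f. h q * Y q f) = h p * B Y)"

lemma tensorial_at_sum:
  fixes h :: "'i::finite \<Rightarrow> 'g \<Rightarrow> real"
  assumes "tensorial_at p B" "\<And>i. smooth_fun A (h i)" "\<And>i. Y i \<in> vector_fields A"
  shows "B (\<lambda>q f. \<Sum>i\<in>UNIV. h i q * Y i q f) = (\<Sum>i\<in>UNIV. h i p * B (Y i))"
proof -
  have "B (\<lambda>q f. \<Sum>i\<in>UNIV. h i q * Y i q f) = (\<Sum>i\<in>UNIV. B (\<lambda>q f. h i q * Y i q f))"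
    using assms additive_sum[of B UNIV "\<lambda>i q f. h i q * Y i q f"]
    by (simp add: tensorial_at_def vector_fields_scale)
  then show ?thesis
    using assms by (simp add: tensorial_at_def)
qed

end

section \<open>Metric traces in an orthogonal frame\<close>

text \<open>\<open>matrix_inv\<close> is a choice. For square matrices a one-sided inverse is
  two-sided, so the choice has a witness, and uniqueness of inverses identifies it.\<close>

lemma matrix_inv_eq_right_inverse:
  fixes M N :: "real ^ 'n ^ 'n"
  assumes "M ** N = mat 1"
  shows "matrix_inv M = N"
proof -
  have "N ** M = mat 1"
    using assms matrix_left_right_inverse by blast
  then have "M ** matrix_inv M = mat 1"
    using assms someI[of "\<lambda>N. M ** N = mat 1 \<and> N ** M = mat 1" N]
    unfolding matrix_inv_def by blast
  then have "N ** (M ** matrix_inv M) = N"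
    by simp
  then show ?thesis
    using \<open>N ** M = mat 1\<close> by (simp add: matrix_mul_assoc)
qed

lemma matrix_inv_congruence:
  fixes C P H K :: "real ^ 'n ^ 'n"
  assumes "P ** C = mat 1" "H ** K = mat 1"
  shows "matrix_inv (C ** H ** transpose C) = transpose P ** K ** P"
proof (rule matrix_inv_eq_right_inverse)
  have "transpose C ** transpose P = mat 1"
    using assms(1) by (metis matrix_transpose_mul transpose_mat)
  moreover have "C ** P = mat 1"
    using assms(1) matrix_left_right_inverse by blast
  ultimately show "C ** H ** transpose C ** (transpose P ** K ** P) = mat 1"
    using assms(2) by (metis matrix_mul_assoc matrix_mul_rid)
qed

text \<open>Basis independence of the metric trace in matrix form. Under a change of basis
  \<open>C\<close> the Gram matrix \<open>H\<close> and the form \<open>B\<close> both transform by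
  congruence, and cyclicity of the trace cancels every \<open>C\<close>.\<close>

lemma trace_matrix_inv_congruence:
  fixes C P H K B :: "real ^ 'n ^ 'n"
  assumes "P ** C = mat 1" "H ** K = mat 1"
  shows "trace (transpose (matrix_inv (C ** H ** transpose C)) ** (C ** B ** transpose C))
    = trace (transpose K ** B)"
proof -
  have "transpose C ** transpose P = mat 1"
    using assms(1) by (metis matrix_transpose_mul transpose_mat)
  have "transpose (transpose P ** K ** P) ** (C ** B ** transpose C)
      = transpose P ** transpose K ** (P ** C) ** B ** transpose C"
    by (simp add: matrix_transpose_mul matrix_mul_assoc)
  also have "\<dots> = transpose P ** (transpose K ** B ** transpose C)"
    using assms(1) by (simp add: matrix_mul_assoc)
  finally have "trace (transpose (transpose P ** K ** P) ** (C ** B ** transpose C))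
      = trace (transpose P ** (transpose K ** B ** transpose C))"
    by simp
  also have "\<dots> = trace (transpose K ** B ** (transpose C ** transpose P))"
    by (subst trace_mul_sym) (simp add: matrix_mul_assoc)
  finally show ?thesis
    using assms \<open>transpose C ** transpose P = mat 1\<close> by (simp add: matrix_inv_congruence)
qed

lemma sum_mult_eq_trace:
  fixes M N :: "real ^ 'n ^ 'n"
  shows "(\<Sum>i\<in>UNIV. \<Sum>j\<in>UNIV. M $ i $ j * N $ i $ j) = trace (transpose M ** N)"
  by (subst sum.swap) (simp add: trace_def matrix_matrix_mult_def transpose_def)

text \<open>The squared lengths \<open>\<eta> i\<close> may have either sign but do not depend on
  the point, so every \<open>g (X i) (X j)\<close> is a constant function.\<close>

locale orthogonal_frame = smooth_manifold A
  for A :: "('g::topological_space, 'n::finite) chart set" +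
  fixes g :: "'g tensor2" and X :: "'n \<Rightarrow> 'g vfield" and \<eta> :: "'n \<Rightarrow> real"
  assumes metric: "pseudo_riemannian_metric A g"
    and frame_field: "X i \<in> vector_fields A"
    and frame_basis: "tangent_basis A p (\<lambda>i. X i p)"
    and orthogonal: "g p (X i p) (X j p) = (if i = j then \<eta> i else 0)"
    and eta_nonzero: "\<eta> i \<noteq> 0"
begin

section \<open>Expansion of fields and bilinear forms in the frame\<close>

lemma metric_sym:
  "v \<in> tangent_space A p \<Longrightarrow> w \<in> tangent_space A p \<Longrightarrow> g p v w = g p w v"
  using metric by (simp add: pseudo_riemannian_metric_def)

lemma tensorial_at_metric1:
  assumes "w \<in> tangent_space A p"
  shows "tensorial_at p (\<lambda>Y. g p (Y p) w)"
  unfolding tensorial_at_def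
proof (intro conjI ballI allI impI)
  fix Y Z assume "Y \<in> vector_fields A" "Z \<in> vector_fields A"
  then show "g p (\<lambda>f. Y p f + Z p f) w = g p (Y p) w + g p (Z p) w"
    using metric assms vector_field_tangent[of Y p] vector_field_tangent[of Z p]
    unfolding pseudo_riemannian_metric_def by blast
next
  fix Y h assume "Y \<in> vector_fields A"
  then show "g p (\<lambda>f. h p * Y p f) w = h p * g p (Y p) w"
    using metric assms vector_field_tangent[of Y p]
    unfolding pseudo_riemannian_metric_def by blast
qed

lemma tensorial_at_metric2:
  assumes "w \<in> tangent_space A p"
  shows "tensorial_at p (\<lambda>Y. g p w (Y p))"
proof -
  have "g p w (Y p) = g p (Y p) w" if "Y \<in> vector_fields A" for Y
    using metric_sym assms vector_field_tangent that by blast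
  note sym = this this[OF vector_fields_add] this[OF vector_fields_scale]
  show ?thesis
    using tensorial_at_metric1[OF assms] by (simp add: tensorial_at_def sym)
qed

text \<open>Reading coordinates off the metric makes their smoothness a consequence of the
  smoothness of \<open>g\<close>; \<open>tangent_basis\<close> provides only pointwise
  coefficients.\<close>

definition coord :: "'g vfield \<Rightarrow> 'n \<Rightarrow> 'g \<Rightarrow> real"
  where "coord Y a p = g p (Y p) (X a p) / \<eta> a"

lemma smooth_coord:
  assumes "Y \<in> vector_fields A"
  shows "smooth_fun A (coord Y a)"
proof -
  have "smooth_fun A (\<lambda>p. g p (Y p) (X a p))"
    using metric assms frame_field by (simp add: pseudo_riemannian_metric_def)
  then have "smooth_fun A (\<lambda>p. inverse (\<eta> a) * g p (Y p) (X a p))"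
    by (intro smooth_fun_mult smooth_fun_const)
  then show ?thesis
    by (simp add: coord_def[abs_def] field_simps)
qed

lemma metric_frame_sum:
  "g p (\<lambda>f. \<Sum>a\<in>UNIV. c a * X a p f) (X b p) = c b * \<eta> b"
proof -
  have "g p (\<lambda>f. \<Sum>a\<in>UNIV. c a * X a p f) (X b p) = (\<Sum>a\<in>UNIV. c a * g p (X a p) (X b p))"
    using tensorial_at_sum[OF tensorial_at_metric1[OF vector_field_tangent[OF frame_field]]
        smooth_fun_const frame_field] .
  then show ?thesis
    by (simp add: orthogonal mult_delta_right)
qed

text \<open>The coefficients supplied at each point by the basis property are identified by pairing
  with \<open>X a\<close>, because the frame is orthogonal and \<open>\<eta> a\<close> is
  nonzero.\<close>

lemma coord_expansion:
  assumes "Y \<in> vector_fields A"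
  shows "Y = (\<lambda>p f. \<Sum>a\<in>UNIV. coord Y a p * X a p f)"
proof
  fix p
  obtain c :: "real ^ 'n" where c: "Y p = (\<lambda>f. \<Sum>a\<in>UNIV. c $ a * X a p f)"
    using frame_basis vector_field_tangent[OF assms, of p] unfolding tangent_basis_def by blast
  then have "coord Y a p = c $ a" for a
    using metric_frame_sum eta_nonzero by (simp add: coord_def)
  then show "Y p = (\<lambda>f. \<Sum>a\<in>UNIV. coord Y a p * X a p f)"
    using c by simp
qed

lemma frame_coefficients_unique:
  assumes "(\<lambda>f. \<Sum>a\<in>UNIV. c a * X a p f) = (\<lambda>f. \<Sum>a\<in>UNIV. d a * X a p f)"
  shows "c a = d a"
  using arg_cong[OF assms, of "\<lambda>v. g p v (X a p)"] eta_nonzero by (simp add: metric_frame_sum)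

lemma bitensorial_expansion:
  assumes "\<And>Z. Z \<in> vector_fields A \<Longrightarrow> tensorial_at p (\<lambda>Y. B Y Z)"
    and "\<And>Y. Y \<in> vector_fields A \<Longrightarrow> tensorial_at p (B Y)"
    and "Y \<in> vector_fields A" "Z \<in> vector_fields A"
  shows "B Y Z = (\<Sum>a\<in>UNIV. coord Y a p * (\<Sum>b\<in>UNIV. coord Z b p * B (X a) (X b)))"
proof -
  have "B Y Z = (\<Sum>a\<in>UNIV. coord Y a p * B (X a) Z)"
    using tensorial_at_sum[OF assms(1), of Z "coord Y" X] smooth_coord frame_field assms(3,4)
    unfolding coord_expansion[OF assms(3), symmetric] by blast
  moreover have "B V Z = (\<Sum>b\<in>UNIV. coord Z b p * B V (X b))" if "V \<in> vector_fields A" for V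
    using tensorial_at_sum[OF assms(2)[OF that], of "coord Z" X] smooth_coord frame_field assms(4)
    unfolding coord_expansion[OF assms(4), symmetric] by blast
  ultimately show ?thesis
    by (simp add: frame_field)
qed

text \<open>The Gram matrix of \<open>E\<close> and the matrix of \<open>B\<close> on
  \<open>E\<close> are congruent, by the same coordinate matrix, to their counterparts in the frame.
  The trace can therefore be taken in the frame, where the metric is diagonal.\<close>

lemma metric_trace_eq:
  fixes E :: "'n \<Rightarrow> 'g vfield"
  assumes E: "basis_fields A p E"
    and B: "\<And>Z. Z \<in> vector_fields A \<Longrightarrow> tensorial_at p (\<lambda>Y. B Y Z)"
      "\<And>Y. Y \<in> vector_fields A \<Longrightarrow> tensorial_at p (B Y)"
  shows "(\<Sum>i\<in>UNIV. \<Sum>j\<in>UNIV. inverse_gram g E p $ i $ j * B (E i) (E j))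
    = (\<Sum>a\<in>UNIV. B (X a) (X a) / \<eta> a)"
proof -
  define C where "C = (\<chi> i a. coord (E i) a p)"
  define H where "H = (\<chi> a b. if a = b then \<eta> a else 0)"
  define K where "K = (\<chi> a b. if a = b then 1 / \<eta> a else 0)"
  define M where "M = (\<chi> a b. B (X a) (X b))"
  have EV: "E i \<in> vector_fields A" for i
    using E by (simp add: basis_fields_def)
  \<comment> \<open>Expanding the frame back in the basis \<open>E\<close> at \<open>p\<close>
    yields the inverse of the coordinate matrix \<open>C\<close>.\<close>
  have "\<forall>a. \<exists>c::real ^ 'n. X a p = (\<lambda>f. \<Sum>i\<in>UNIV. c $ i * E i p f)"
    using E vector_field_tangent[OF frame_field]
    unfolding basis_fields_def tangent_basis_def by blast
  from choice[OF this] obtain c :: "'n \<Rightarrow> real ^ 'n"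
    where c: "\<And>a. X a p = (\<lambda>f. \<Sum>i\<in>UNIV. c a $ i * E i p f)"
    by blast
  \<comment> \<open>Both sides are \<open>X a p\<close>: on the left written in the frame itself, on
    the right expanded in \<open>E\<close> and then back in the frame. Comparing coefficients gives
    the matrix identity \<open>PC\<close>.\<close>
  have "(\<lambda>f. \<Sum>b\<in>UNIV. (if b = a then 1 else 0) * X b p f)
      = (\<lambda>f. \<Sum>b\<in>UNIV. (\<Sum>i\<in>UNIV. c a $ i * C $ i $ b) * X b p f)" for a
  proof
    fix f
    have "X a p f = (\<Sum>i\<in>UNIV. c a $ i * (\<Sum>b\<in>UNIV. C $ i $ b * X b p f))"
    proof -
      have "E i p f = (\<Sum>b\<in>UNIV. C $ i $ b * X b p f)" for i
        using fun_cong[OF fun_cong[OF coord_expansion[OF EV]]] by (simp add: C_def)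
      then have "(\<Sum>i\<in>UNIV. c a $ i * E i p f)
          = (\<Sum>i\<in>UNIV. c a $ i * (\<Sum>b\<in>UNIV. C $ i $ b * X b p f))"
        by simp
      then show ?thesis
        using fun_cong[OF c] by (rule trans[rotated])
    qed
    also have "\<dots> = (\<Sum>b\<in>UNIV. (\<Sum>i\<in>UNIV. c a $ i * C $ i $ b) * X b p f)"
      by (simp add: sum_distrib_left sum_distrib_right mult.assoc) (rule sum.swap)
    finally show "(\<Sum>b\<in>UNIV. (if b = a then 1 else 0) * X b p f)
      = (\<Sum>b\<in>UNIV. (\<Sum>i\<in>UNIV. c a $ i * C $ i $ b) * X b p f)"
      by (simp add: mult_delta_left)
  qed
  from frame_coefficients_unique[OF this, symmetric]
  have "(\<Sum>i\<in>UNIV. c a $ i * C $ i $ b) = (if b = a then 1 else 0)" for a b .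
  then have PC: "(\<chi> a i. c a $ i) ** C = mat 1"
    by (simp add: matrix_matrix_mult_def mat_def vec_eq_iff)
  have HK: "H ** K = mat 1"
    by (simp add: H_def K_def matrix_matrix_mult_def mat_def vec_eq_iff mult_delta_left eta_nonzero)
  \<comment> \<open>Stated for arbitrary \<open>F\<close> because it is applied twice, to the metric
    and to \<open>B\<close>.\<close>
  have congr: "(\<chi> i j. F (E i) (E j)) = C ** (\<chi> a b. F (X a) (X b)) ** transpose C"
    if "\<And>Z. Z \<in> vector_fields A \<Longrightarrow> tensorial_at p (\<lambda>Y. F Y Z)"
      "\<And>Y. Y \<in> vector_fields A \<Longrightarrow> tensorial_at p (F Y)" for F
  proof -
    have "F (E i) (E j) = (\<Sum>b\<in>UNIV. (\<Sum>a\<in>UNIV. C $ i $ a * F (X a) (X b)) * C $ j $ b)" for i j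
    proof -
      have "F (E i) (E j)
          = (\<Sum>a\<in>UNIV. C $ i $ a * (\<Sum>b\<in>UNIV. C $ j $ b * F (X a) (X b)))"
        using that EV by (subst bitensorial_expansion[where B = F]) (simp_all add: C_def)
      then show ?thesis
        by (simp add: sum_distrib_left sum_distrib_right mult_ac) (rule sum.swap)
    qed
    then show ?thesis
      by (simp add: matrix_matrix_mult_def transpose_def vec_eq_iff)
  qed
  have "(\<chi> i j. g p (E i p) (E j p)) = C ** H ** transpose C"
    using congr[of "\<lambda>Y Z. g p (Y p) (Z p)"]
    by (simp add: tensorial_at_metric1 tensorial_at_metric2 vector_field_tangent orthogonal H_def)
  moreover have "(\<chi> i j. B (E i) (E j)) = C ** M ** transpose C"
    using congr[OF B] by (simp add: M_def)
  then have "(\<Sum>i\<in>UNIV. \<Sum>j\<in>UNIV. inverse_gram g E p $ i $ j * B (E i) (E j))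
      = trace (transpose (inverse_gram g E p) ** (C ** M ** transpose C))"
    by (simp add: sum_mult_eq_trace[symmetric] vec_eq_iff)
  ultimately have "(\<Sum>i\<in>UNIV. \<Sum>j\<in>UNIV. inverse_gram g E p $ i $ j * B (E i) (E j))
      = trace (transpose K ** M)"
    by (simp add: inverse_gram_def trace_matrix_inv_congruence[OF PC HK])
  also have "\<dots> = (\<Sum>a\<in>UNIV. B (X a) (X a) / \<eta> a)"
    by (simp add: sum_mult_eq_trace[symmetric] K_def M_def mult_delta_left)
  finally show ?thesis .
qed

end

section \<open>The Levi-Civita connection of a bi-invariant metric\<close>

text \<open>\<open>C $ i $ j $ k\<close> is the \<open>X k\<close> coefficient of
  \<open>[X i, X j]\<close>, constant over the manifold. \<open>ad_skew\<close> is the invariance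
  \<open>g([X i, X j], X k) + g([X i, X k], X j) = 0\<close> in these constants.\<close>

locale invariant_frame = orthogonal_frame A g X \<eta>
  for A :: "('g::topological_space, 'n::finite) chart set" and g X \<eta> +
  fixes D :: "'g connection" and C :: "real ^ 'n ^ 'n ^ 'n"
  assumes levi_civita: "levi_civita_connection A g D"
    and bracket: "lie_bracket (X i) (X j) = (\<lambda>p f. \<Sum>k\<in>UNIV. C $ i $ j $ k * X k p f)"
    and bracket_skew: "C $ j $ i $ k = - C $ i $ j $ k"
    and ad_skew: "C $ i $ k $ j * \<eta> j = - (C $ i $ j $ k * \<eta> k)"
begin

section \<open>Connection axioms and fields with constant coefficients in the frame\<close>

lemma connection: "affine_connection A D"
  using levi_civita by (simp add: levi_civita_connection_def)

lemma D_field: "Y \<in> vector_fields A \<Longrightarrow> Z \<in> vector_fields A \<Longrightarrow> D Y Z \<in> vector_fields A"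
  using connection by (simp add: affine_connection_def)

lemma D_add1:
  "\<lbrakk>U \<in> vector_fields A; V \<in> vector_fields A; Z \<in> vector_fields A\<rbrakk>
    \<Longrightarrow> D (\<lambda>p f. U p f + V p f) Z = (\<lambda>p f. D U Z p f + D V Z p f)"
  using connection by (simp add: affine_connection_def)

lemma D_scale1:
  "\<lbrakk>U \<in> vector_fields A; Z \<in> vector_fields A; smooth_fun A h\<rbrakk>
    \<Longrightarrow> D (\<lambda>p f. h p * U p f) Z = (\<lambda>p f. h p * D U Z p f)"
  using connection by (simp add: affine_connection_def)

lemma D_add2:
  "\<lbrakk>Z \<in> vector_fields A; U \<in> vector_fields A; V \<in> vector_fields A\<rbrakk>
    \<Longrightarrow> D Z (\<lambda>p f. U p f + V p f) = (\<lambda>p f. D Z U p f + D Z V p f)"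
  using connection by (simp add: affine_connection_def)

lemma D_scale2:
  "\<lbrakk>Z \<in> vector_fields A; U \<in> vector_fields A; smooth_fun A h\<rbrakk>
    \<Longrightarrow> D Z (\<lambda>p f. h p * U p f) = (\<lambda>p f. Z p h * U p f + h p * D Z U p f)"
  using connection by (simp add: affine_connection_def)

lemma D_cmult2:
  assumes "Z \<in> vector_fields A" "U \<in> vector_fields A"
  shows "D Z (\<lambda>p f. c * U p f) = (\<lambda>p f. c * D Z U p f)"
  using D_scale2[OF assms smooth_fun_const[of c]]
  by (simp add: tangent_vector_const[OF vector_field_tangent[OF assms(1)]])

lemma torsion_free:
  "Y \<in> vector_fields A \<Longrightarrow> Z \<in> vector_fields A
    \<Longrightarrow> lie_bracket Y Z = (\<lambda>p f. D Y Z p f - D Z Y p f)"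
  using levi_civita by (simp add: levi_civita_connection_def)

lemma D_metric:
  "\<lbrakk>U \<in> vector_fields A; V \<in> vector_fields A; Z \<in> vector_fields A\<rbrakk>
    \<Longrightarrow> U p (\<lambda>q. g q (V q) (Z q)) = g p (D U V p) (Z p) + g p (V p) (D U Z p)"
  using levi_civita by (simp add: levi_civita_connection_def)

definition frame_comb :: "real ^ 'n \<Rightarrow> 'g vfield"
  where "frame_comb v = (\<lambda>p f. \<Sum>k\<in>UNIV. v $ k * X k p f)"

lemma frame_comb_field: "frame_comb v \<in> vector_fields A"
  unfolding frame_comb_def by (intro vector_fields_sum vector_fields_cmult frame_field) simp

lemma metric_frame_comb: "g p (frame_comb v p) (X a p) = v $ a * \<eta> a"
  by (simp add: frame_comb_def metric_frame_sum)

lemma metric_frame_comb2: "g p (frame_comb v p) (frame_comb w p) = (\<Sum>a\<in>UNIV. \<eta> a * v $ a * w $ a)"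
proof -
  have "g p (frame_comb v p) (\<lambda>f. \<Sum>a\<in>UNIV. w $ a * X a p f)
      = (\<Sum>a\<in>UNIV. w $ a * g p (frame_comb v p) (X a p))"
    by (intro tensorial_at_sum[OF tensorial_at_metric2[OF vector_field_tangent]])
      (auto intro: smooth_fun_const frame_field frame_comb_field)
  then show ?thesis
    by (simp add: metric_frame_comb mult_ac) (simp add: frame_comb_def)
qed

lemma bracket_frame_comb: "lie_bracket (X i) (X j) = frame_comb (C $ i $ j)"
  by (simp add: bracket frame_comb_def)

text \<open>Koszul's formula; for a bi-invariant metric it collapses to half of the bracket.\<close>

lemma D_frame: "D (X i) (X j) = frame_comb ((1/2) *\<^sub>R C $ i $ j)"
proof -
  note F = frame_field and DF = D_field[OF frame_field frame_field]
  have "g p (D (X i) (X j) p) (X k p) = C $ i $ j $ k * \<eta> k / 2" for p i j k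
  proof -
    define \<Gamma> where "\<Gamma> i j k = g p (D (X i) (X j) p) (X k p)" for i j k
    \<comment> \<open>Metric compatibility: the left side of \<open>D_metric\<close> differentiates
      a constant.\<close>
    have 1: "\<Gamma> i j k = - \<Gamma> i k j" for i j k
    proof -
      have "g p (D (X i) (X j) p) (X k p) + g p (X j p) (D (X i) (X k) p) = 0"
        using D_metric[OF F F F, of i p j k]
        by (simp add: orthogonal tangent_vector_const[OF vector_field_tangent[OF F]])
      then show ?thesis
        using metric_sym[OF vector_field_tangent[OF F] vector_field_tangent[OF DF]]
        by (simp add: \<Gamma>_def)
    qed
    have 2: "\<Gamma> i j k - \<Gamma> j i k = C $ i $ j $ k * \<eta> k" for i j k
    proof -
      have "D (X i) (X j) p = (\<lambda>f. lie_bracket (X i) (X j) p f + D (X j) (X i) p f)"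
        by (simp add: torsion_free[OF F F])
      then have "g p (D (X i) (X j) p) (X k p)
          = g p (lie_bracket (X i) (X j) p) (X k p) + g p (D (X j) (X i) p) (X k p)"
        using tensorial_at_metric1[OF vector_field_tangent[OF F]] DF
          frame_comb_field[of "C $ i $ j"]
        by (simp add: tensorial_at_def bracket_frame_comb)
      then show ?thesis
        by (simp add: \<Gamma>_def bracket_frame_comb metric_frame_comb)
    qed
    \<comment> \<open>Skew-symmetry and invariance make
      \<open>T i j k = C $ i $ j $ k * \<eta> k\<close> cyclically symmetric. In the Koszul identity
      \<open>2 * \<Gamma> i j k = T i j k - T j k i + T k i j\<close> the last two terms then
      cancel.\<close>
    have "C $ j $ k $ i * \<eta> i = C $ i $ j $ k * \<eta> k" "C $ k $ i $ j * \<eta> j = C $ i $ j $ k * \<eta> k"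
      using ad_skew[of j k i] ad_skew[of i j k] bracket_skew[of j i k] bracket_skew[of i k j]
      by simp_all
    then have "\<Gamma> i j k = C $ i $ j $ k * \<eta> k / 2"
      using 1[of i j k] 1[of j i k] 1[of k i j] 1[of k j i] 1[of i k j] 1[of j k i]
        2[of i j k] 2[of j k i] 2[of k i j] by linarith
    then show ?thesis
      by (simp add: \<Gamma>_def)
  qed
  then have coord: "coord (D (X i) (X j)) a p = ((1/2) *\<^sub>R C $ i $ j) $ a" for a p
    using eta_nonzero by (simp add: coord_def)
  show ?thesis
    unfolding frame_comb_def by (rule coord_expansion[OF DF, of i j, unfolded coord])
qed

lemma D_frame_comb2:
  "D (X i) (frame_comb v) = frame_comb (\<chi> k. (\<Sum>j\<in>UNIV. v $ j * C $ i $ j $ k) / 2)"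
proof (intro ext)
  fix p f
  have "D (X i) (\<lambda>p f. \<Sum>j\<in>UNIV. v $ j * X j p f) p f
      = (\<Sum>j\<in>UNIV. D (X i) (\<lambda>p f. v $ j * X j p f) p f)"
    by (rule additive_sum) (simp_all add: D_add2 frame_field vector_fields_cmult)
  also have "\<dots> = (\<Sum>j\<in>UNIV. \<Sum>k\<in>UNIV. v $ j * (C $ i $ j $ k / 2) * X k p f)"
    by (simp add: D_cmult2 frame_field D_frame frame_comb_def sum_distrib_left mult.assoc)
  also have "\<dots> = (\<Sum>k\<in>UNIV. (\<Sum>j\<in>UNIV. v $ j * C $ i $ j $ k) / 2 * X k p f)"
    by (subst sum.swap) (simp add: sum_distrib_right sum_divide_distrib)
  finally show "D (X i) (frame_comb v) p f
      = frame_comb (\<chi> k. (\<Sum>j\<in>UNIV. v $ j * C $ i $ j $ k) / 2) p f"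
    by (simp add: frame_comb_def)
qed

lemma D_frame_comb1:
  "D (frame_comb u) (X j) = frame_comb (\<chi> k. (\<Sum>i\<in>UNIV. u $ i * C $ i $ j $ k) / 2)"
proof (intro ext)
  fix p f
  have "D (\<lambda>p f. \<Sum>i\<in>UNIV. u $ i * X i p f) (X j) p f
      = (\<Sum>i\<in>UNIV. D (\<lambda>p f. u $ i * X i p f) (X j) p f)"
    by (rule additive_sum[where B = "\<lambda>Y. D Y (X j) p f"])
      (simp_all add: D_add1 frame_field vector_fields_cmult)
  also have "\<dots> = (\<Sum>i\<in>UNIV. \<Sum>k\<in>UNIV. u $ i * (C $ i $ j $ k / 2) * X k p f)"
    by (simp add: D_scale1[OF _ _ smooth_fun_const] frame_field D_frame frame_comb_def
        sum_distrib_left mult.assoc)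
  also have "\<dots> = (\<Sum>k\<in>UNIV. (\<Sum>i\<in>UNIV. u $ i * C $ i $ j $ k) / 2 * X k p f)"
    by (subst sum.swap) (simp add: sum_distrib_right sum_divide_distrib)
  finally show "D (frame_comb u) (X j) p f
      = frame_comb (\<chi> k. (\<Sum>i\<in>UNIV. u $ i * C $ i $ j $ k) / 2) p f"
    by (simp add: frame_comb_def)
qed

lemma frame_comb_diff: "(\<lambda>f. frame_comb v p f - frame_comb w p f) = frame_comb (v - w) p"
  by (simp add: frame_comb_def sum_subtractf left_diff_distrib)

text \<open>The field-valued counterpart of \<open>tensorial_at\<close>; pairing with a fixed
  tangent vector by \<open>g\<close> passes from one to the other.\<close>

definition tensorial :: "('g vfield \<Rightarrow> 'g vfield) \<Rightarrow> bool"
  where "tensorial T \<longleftrightarrow>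
    (\<forall>Y\<in>vector_fields A. T Y \<in> vector_fields A) \<and>
    (\<forall>Y\<in>vector_fields A. \<forall>Z\<in>vector_fields A.
       T (\<lambda>p f. Y p f + Z p f) = (\<lambda>p f. T Y p f + T Z p f)) \<and>
    (\<forall>Y\<in>vector_fields A. \<forall>h. smooth_fun A h \<longrightarrow> T (\<lambda>p f. h p * Y p f) = (\<lambda>p f. h p * T Y p f))"

lemma tensorial_imp_tensorial_at1:
  "tensorial T \<Longrightarrow> w \<in> tangent_space A p \<Longrightarrow> tensorial_at p (\<lambda>Y. g p (T Y p) w)"
  using tensorial_at_metric1[of w p] by (simp add: tensorial_def tensorial_at_def)

lemma tensorial_imp_tensorial_at2:
  "tensorial T \<Longrightarrow> w \<in> tangent_space A p \<Longrightarrow> tensorial_at p (\<lambda>Y. g p w (T Y p))"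
  using tensorial_at_metric2[of w p] by (simp add: tensorial_def tensorial_at_def)

lemma bitensorial_metric_trace:
  fixes E :: "'n \<Rightarrow> 'g vfield"
  assumes "basis_fields A p E" "tensorial S" "tensorial T"
  shows "(\<Sum>i\<in>UNIV. \<Sum>j\<in>UNIV. inverse_gram g E p $ i $ j * g p (S (E i) p) (T (E j) p))
    = (\<Sum>a\<in>UNIV. g p (S (X a) p) (T (X a) p) / \<eta> a)"
  using assms
  by (intro metric_trace_eq tensorial_imp_tensorial_at1 tensorial_imp_tensorial_at2)
    (auto simp: tensorial_def intro: vector_field_tangent)

end

section \<open>The square norm of the derivative of an almost complex structure\<close>

text \<open>Column \<open>j\<close> of the constant matrix \<open>M\<close> holds the frame
  coordinates of \<open>J (X j)\<close>.\<close>

locale almost_complex_frame = invariant_frame A g X \<eta> D C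
  for A :: "('g::topological_space, 'n::finite) chart set" and g X \<eta> D C +
  fixes J :: "'g endofield" and M :: "real ^ 'n ^ 'n"
  assumes complex: "almost_complex_structure A J"
    and J_frame: "J p (X j p) = (\<lambda>f. \<Sum>a\<in>UNIV. M $ a $ j * X a p f)"
begin

lemma J_field: "Y \<in> vector_fields A \<Longrightarrow> (\<lambda>p. J p (Y p)) \<in> vector_fields A"
  using complex by (simp add: almost_complex_structure_def)

lemma J_add:
  "\<lbrakk>v \<in> tangent_space A p; w \<in> tangent_space A p\<rbrakk>
    \<Longrightarrow> J p (\<lambda>f. v f + w f) = (\<lambda>f. J p v f + J p w f)"
  using complex by (simp add: almost_complex_structure_def)

lemma J_scale:
  "v \<in> tangent_space A p \<Longrightarrow> J p (\<lambda>f. c * v f) = (\<lambda>f. c * J p v f)"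
  using complex by (simp add: almost_complex_structure_def)

lemma nabla_endo_field:
  assumes "Y \<in> vector_fields A" "Z \<in> vector_fields A"
  shows "nabla_endo D J Y Z \<in> vector_fields A"
proof -
  have "(\<lambda>p f. D Y (\<lambda>q. J q (Z q)) p f + (-1) * J p (D Y Z p) f) \<in> vector_fields A"
    using assms
    by (intro vector_fields_add vector_fields_cmult[of "\<lambda>p. J p (D Y Z p)"] D_field J_field)
  then show ?thesis
    by (simp add: nabla_endo_def)
qed

lemma tensorial_nabla_endo1:
  assumes "Z \<in> vector_fields A"
  shows "tensorial (\<lambda>Y. nabla_endo D J Y Z)"
  using assms
  by (auto simp: tensorial_def nabla_endo_field)
     (simp_all add: nabla_endo_def D_add1 D_scale1 J_field J_add J_scale D_field
       vector_field_tangent[OF D_field],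
      simp_all add: algebra_simps)

text \<open>The Leibniz term \<open>Y(h) J Z\<close> arises once from differentiating
  \<open>h J Z\<close> and once from applying \<open>J\<close> to the derivative of
  \<open>h Z\<close>; the two cancel.\<close>

lemma tensorial_nabla_endo2:
  assumes "Y \<in> vector_fields A"
  shows "tensorial (nabla_endo D J Y)"
  using assms
  by (auto simp: tensorial_def nabla_endo_field)
     (simp_all add: nabla_endo_def D_add2 D_scale2 J_field J_add J_scale D_field
       vector_field_tangent[OF D_field] vector_field_tangent tangent_space_scale,
      simp_all add: algebra_simps)

lemma J_frame_comb: "J p (frame_comb v p) = frame_comb (M *v v) p"
proof
  fix f
  have "J p (\<lambda>f. \<Sum>j\<in>UNIV. v $ j * X j p f) f = (\<Sum>j\<in>UNIV. J p (\<lambda>f. v $ j * X j p f) f)"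
    by (rule additive_sum[where B = "\<lambda>Y. J p (Y p) f" and Y = "\<lambda>j p f. v $ j * X j p f"])
      (simp_all add: J_add vector_field_tangent frame_field vector_fields_cmult)
  also have "\<dots> = (\<Sum>j\<in>UNIV. \<Sum>a\<in>UNIV. M $ a $ j * v $ j * X a p f)"
    by (simp add: J_scale vector_field_tangent[OF frame_field] J_frame sum_distrib_left mult_ac)
  also have "\<dots> = (\<Sum>a\<in>UNIV. (\<Sum>j\<in>UNIV. M $ a $ j * v $ j) * X a p f)"
    by (subst sum.swap) (simp add: sum_distrib_right)
  finally show "J p (frame_comb v p) f = frame_comb (M *v v) p f"
    by (simp add: frame_comb_def matrix_vector_mult_def)
qed

text \<open>Since \<open>D\<close> is half the bracket on the frame, this is
  \<open>([X i, J X k] - J [X i, X k]) / 2\<close> in coordinates.\<close>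

lemma nabla_endo_frame:
  "nabla_endo D J (X i) (X k) p = frame_comb (\<chi> a.
    ((\<Sum>j\<in>UNIV. M $ j $ k * C $ i $ j $ a) - (\<Sum>b\<in>UNIV. M $ a $ b * C $ i $ k $ b)) / 2) p"
proof -
  have "(\<lambda>q. J q (X k q)) = frame_comb (\<chi> j. M $ j $ k)"
    by (simp add: frame_comb_def J_frame)
  then have "nabla_endo D J (X i) (X k) p
      = (\<lambda>f. frame_comb (\<chi> a. (\<Sum>j\<in>UNIV. M $ j $ k * C $ i $ j $ a) / 2) p f
        - frame_comb (M *v ((1/2) *\<^sub>R C $ i $ k)) p f)"
    by (simp add: nabla_endo_def D_frame_comb2 D_frame J_frame_comb)
  then show ?thesis
    by (simp add: frame_comb_diff matrix_vector_mult_def diff_divide_distrib sum_divide_distrib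
        minus_vec_def)
qed

text \<open>Two successive metric traces: first over \<open>k\<close>, \<open>l\<close> with the
  directions of differentiation fixed, then over \<open>i\<close>, \<open>j\<close> with the
  differentiated field \<open>X k\<close> fixed.\<close>

lemma nabla_norm_sq_eq:
  fixes E :: "'n \<Rightarrow> 'g vfield"
  assumes "basis_fields A p E"
  shows "nabla_norm_sq g D J E p = (\<Sum>k\<in>UNIV. \<Sum>i\<in>UNIV. \<Sum>a\<in>UNIV. \<eta> a *
    ((\<Sum>j\<in>UNIV. M $ j $ k * C $ i $ j $ a) - (\<Sum>b\<in>UNIV. M $ a $ b * C $ i $ k $ b))\<^sup>2
      / (4 * \<eta> i * \<eta> k))"
proof -
  let ?N = "\<lambda>Y Z. nabla_endo D J Y Z p"
  let ?G = "inverse_gram g E p"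
  have EV: "E i \<in> vector_fields A" for i
    using assms by (simp add: basis_fields_def)
  have "nabla_norm_sq g D J E p = (\<Sum>i\<in>UNIV. \<Sum>j\<in>UNIV. ?G $ i $ j *
      (\<Sum>k\<in>UNIV. \<Sum>l\<in>UNIV. ?G $ k $ l * g p (?N (E i) (E k)) (?N (E j) (E l))))"
    by (simp add: nabla_norm_sq_def sum_distrib_left mult.assoc)
  also have "\<dots> = (\<Sum>i\<in>UNIV. \<Sum>j\<in>UNIV. ?G $ i $ j *
      (\<Sum>k\<in>UNIV. g p (?N (E i) (X k)) (?N (E j) (X k)) / \<eta> k))"
    by (simp add: bitensorial_metric_trace[OF assms tensorial_nabla_endo2 tensorial_nabla_endo2] EV)
  also have "\<dots> = (\<Sum>i\<in>UNIV. \<Sum>k\<in>UNIV. \<Sum>j\<in>UNIV.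
      ?G $ i $ j * g p (?N (E i) (X k)) (?N (E j) (X k)) / \<eta> k)"
    by (simp add: sum_distrib_left) (intro sum.cong refl sum.swap)
  also have "\<dots> = (\<Sum>k\<in>UNIV. (\<Sum>i\<in>UNIV. \<Sum>j\<in>UNIV.
      ?G $ i $ j * g p (?N (E i) (X k)) (?N (E j) (X k))) / \<eta> k)"
    by (subst sum.swap) (simp add: sum_divide_distrib)
  also have "\<dots> = (\<Sum>k\<in>UNIV. (\<Sum>i\<in>UNIV. g p (?N (X i) (X k)) (?N (X i) (X k)) / \<eta> i) / \<eta> k)"
    by (simp add: bitensorial_metric_trace[OF assms tensorial_nabla_endo1 tensorial_nabla_endo1]
        frame_field)
  finally show ?thesis
    by (simp add: nabla_endo_frame metric_frame_comb2 sum_divide_distrib power2_eq_square mult_ac)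
qed

end

section \<open>Scalar curvature\<close>

context invariant_frame
begin

text \<open>Torsion-freeness eliminates the bracket, so the tensoriality proofs can work with the
  axioms of \<open>D\<close> alone.\<close>

lemma curvature_eq:
  assumes "U \<in> vector_fields A" "V \<in> vector_fields A" "Z \<in> vector_fields A"
  shows "curvature D U V Z
    = (\<lambda>p f. D U (D V Z) p f - D V (D U Z) p f - D (D U V) Z p f + D (D V U) Z p f)"
proof -
  have DV: "D U V \<in> vector_fields A" "D V U \<in> vector_fields A"
    using assms D_field by auto
  \<comment> \<open>The difference is written with the factor -1 because the axioms of
    \<open>D\<close> speak of sums and multiples only.\<close>
  have "lie_bracket U V = (\<lambda>p f. D U V p f + (-1) * D V U p f)"
    by (simp add: torsion_free assms)
  then have "D (lie_bracket U V) Z = (\<lambda>p f. D (D U V) Z p f - D (D V U) Z p f)"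
    using D_add1[OF DV(1) vector_fields_cmult[OF DV(2), of "-1"] assms(3)]
      D_scale1[OF DV(2) assms(3) smooth_fun_const[of "-1"]] by simp
  then show ?thesis
    by (simp add: curvature_def) (simp add: algebra_simps)
qed

lemma curvature_field:
  assumes "U \<in> vector_fields A" "V \<in> vector_fields A" "Z \<in> vector_fields A"
  shows "curvature D U V Z \<in> vector_fields A"
proof -
  have "(\<lambda>p f. D U (D V Z) p f + ((-1) * D V (D U Z) p f
      + ((-1) * D (D U V) Z p f + D (D V U) Z p f))) \<in> vector_fields A"
    by (intro vector_fields_add vector_fields_cmult D_field assms)
  then show ?thesis
    by (simp add: curvature_eq[OF assms] algebra_simps)
qed

lemmas D_rules = D_field D_add1 D_scale1 D_add2 D_scale2 vector_fields_add vector_fields_scale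
  vector_field_smooth

text \<open>Scaling \<open>U\<close> by \<open>h\<close> produces the extra term
  \<open>V(h) D U Z\<close> twice with opposite signs: from \<open>D V (h D U Z)\<close> and from
  \<open>D (D V (h U)) Z\<close>.\<close>

lemma tensorial_curvature1:
  assumes "V \<in> vector_fields A" "Z \<in> vector_fields A"
  shows "tensorial (\<lambda>U. curvature D U V Z)"
  unfolding tensorial_def
proof (intro conjI ballI allI impI)
  fix U assume U: "U \<in> vector_fields A"
  show "curvature D U V Z \<in> vector_fields A"
    by (intro curvature_field U assms)
  show "curvature D (\<lambda>p f. h p * U p f) V Z = (\<lambda>p f. h p * curvature D U V Z p f)"
    if "smooth_fun A h" for h
    using that assms U by (simp add: curvature_eq D_rules) (simp add: algebra_simps)
  fix U' assume "U' \<in> vector_fields A"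
  then show "curvature D (\<lambda>p f. U p f + U' p f) V Z
      = (\<lambda>p f. curvature D U V Z p f + curvature D U' V Z p f)"
    using assms U by (simp add: curvature_eq D_rules) (simp add: algebra_simps)
qed

lemma tensorial_curvature2:
  assumes "U \<in> vector_fields A" "Z \<in> vector_fields A"
  shows "tensorial (\<lambda>V. curvature D U V Z)"
  unfolding tensorial_def
proof (intro conjI ballI allI impI)
  fix V assume V: "V \<in> vector_fields A"
  show "curvature D U V Z \<in> vector_fields A"
    by (intro curvature_field V assms)
  show "curvature D U (\<lambda>p f. h p * V p f) Z = (\<lambda>p f. h p * curvature D U V Z p f)"
    if "smooth_fun A h" for h
    using that assms V by (simp add: curvature_eq D_rules) (simp add: algebra_simps)
  fix V' assume "V' \<in> vector_fields A"
  then show "curvature D U (\<lambda>p f. V p f + V' p f) Z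
      = (\<lambda>p f. curvature D U V Z p f + curvature D U V' Z p f)"
    using assms V by (simp add: curvature_eq D_rules) (simp add: algebra_simps)
qed

lemma tensorial_curvature3:
  assumes "U \<in> vector_fields A" "V \<in> vector_fields A"
  shows "tensorial (curvature D U V)"
  unfolding tensorial_def
proof (intro conjI ballI allI impI)
  fix Z assume Z: "Z \<in> vector_fields A"
  show "curvature D U V Z \<in> vector_fields A"
    by (intro curvature_field Z assms)
  show "curvature D U V (\<lambda>p f. h p * Z p f) = (\<lambda>p f. h p * curvature D U V Z p f)"
    if h: "smooth_fun A h" for h
  proof (intro ext)
    fix p f
    \<comment> \<open>The second derivatives of \<open>h\<close> left over in the curvature form
      \<open>[U, V] h\<close>, which torsion-freeness matches against the first-order terms from
      \<open>D U V\<close> and \<open>D V U\<close>.\<close>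
    have commutator: "U p (\<lambda>p. V p h) = V p (\<lambda>p. U p h) + D U V p h - D V U p h"
      using fun_cong[OF fun_cong[OF torsion_free[OF assms]], of p h] by (simp add: lie_bracket_def)
    show "curvature D U V (\<lambda>p f. h p * Z p f) p f = h p * curvature D U V Z p f"
      using h assms Z by (simp add: curvature_eq D_rules) (simp add: commutator algebra_simps)
  qed
  fix Z' assume "Z' \<in> vector_fields A"
  then show "curvature D U V (\<lambda>p f. Z p f + Z' p f)
      = (\<lambda>p f. curvature D U V Z p f + curvature D U V Z' p f)"
    using assms Z by (simp add: curvature_eq D_rules) (simp add: algebra_simps)
qed

text \<open>Here \<open>D (X b) (X b) = 0\<close>, and the two other terms are
  \<open>-[b,[a,b]]/4\<close> and \<open>+[b,[a,b]]/2\<close>. Only equal last arguments are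
  treated, as the Ricci trace in the frame is diagonal.\<close>

lemma curvature_frame:
  "curvature D (X a) (X b) (X b)
    = frame_comb (\<chi> k. (\<Sum>j\<in>UNIV. C $ a $ b $ j * C $ b $ j $ k) / 4)"
proof -
  have "C $ b $ b $ k = 0" for k
    using bracket_skew[of b b k] by simp
  then have "C $ b $ b = 0"
    by (simp add: vec_eq_iff)
  have "(\<Sum>i\<in>UNIV. C $ a $ b $ i * C $ i $ b $ k)
      = - (\<Sum>j\<in>UNIV. C $ a $ b $ j * C $ b $ j $ k)" for k
    by (subst bracket_skew[of _ b]) (simp add: sum_negf)
  then have vec: "0 - (\<chi> k. (\<Sum>j\<in>UNIV. C $ a $ b $ j / 2 * C $ b $ j $ k) / 2)
      - (\<chi> k. (\<Sum>i\<in>UNIV. C $ a $ b $ i * C $ i $ b $ k) / 2)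
      = (\<chi> k. (\<Sum>j\<in>UNIV. C $ a $ b $ j * C $ b $ j $ k) / 4)"
    by (simp add: vec_eq_iff sum_divide_distrib[symmetric])
  have "curvature D (X a) (X b) (X b) p = frame_comb (0
      - (\<chi> k. (\<Sum>j\<in>UNIV. C $ a $ b $ j / 2 * C $ b $ j $ k) / 2)
      - (\<chi> k. (\<Sum>i\<in>UNIV. C $ a $ b $ i * C $ i $ b $ k) / 2)) p" for p
    using \<open>C $ b $ b = 0\<close>
    by (simp add: curvature_def D_frame D_frame_comb2 bracket_frame_comb D_frame_comb1
        flip: frame_comb_diff) (simp add: frame_comb_def sum_negf)
  then show ?thesis
    unfolding vec by (rule ext)
qed

text \<open>Invariance turns \<open>g([b,[a,b]], a)\<close> into \<open>g([a,b],[a,b])\<close>. The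
  value is the unnormalised sectional curvature.\<close>

lemma sectional_curvature_frame:
  "g p (curvature D (X a) (X b) (X b) p) (X a p) = (\<Sum>j\<in>UNIV. \<eta> j * (C $ a $ b $ j)\<^sup>2) / 4"
proof -
  have "C $ b $ j $ a * \<eta> a = C $ a $ b $ j * \<eta> j" for j
    using ad_skew[of b j a] bracket_skew[of b a j] by simp
  then have "C $ a $ b $ j * (C $ b $ j $ a * \<eta> a) = \<eta> j * (C $ a $ b $ j)\<^sup>2" for j
    by (simp add: power2_eq_square)
  then show ?thesis
    by (simp add: curvature_frame metric_frame_comb sum_distrib_right mult.assoc)
qed

lemma scalar_curvature_eq:
  fixes E :: "'n \<Rightarrow> 'g vfield"
  assumes "basis_fields A p E"
  shows "scalar_curvature g D E p
    = (\<Sum>a\<in>UNIV. \<Sum>b\<in>UNIV. \<Sum>j\<in>UNIV. \<eta> j * (C $ a $ b $ j)\<^sup>2 / (4 * \<eta> a * \<eta> b))"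
proof -
  let ?G = "inverse_gram g E p"
  have EV: "E i \<in> vector_fields A" for i
    using assms by (simp add: basis_fields_def)
  \<comment> \<open>The identity is the second factor when the Ricci contraction is put into the
    form of \<open>bitensorial_metric_trace\<close>.\<close>
  have id: "tensorial (\<lambda>Y. Y)"
    by (simp add: tensorial_def)
  have "ricci g D E Y Z p = (\<Sum>a\<in>UNIV. g p (curvature D (X a) Y Z p) (X a p) / \<eta> a)"
    if "Y \<in> vector_fields A" "Z \<in> vector_fields A" for Y Z
    using bitensorial_metric_trace[OF assms tensorial_curvature1[OF that] id]
    by (simp add: ricci_def)
  then have "scalar_curvature g D E p = (\<Sum>i\<in>UNIV. \<Sum>j\<in>UNIV. \<Sum>a\<in>UNIV.
      ?G $ i $ j * g p (curvature D (X a) (E i) (E j) p) (X a p) / \<eta> a)"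
    by (simp add: scalar_curvature_def EV sum_distrib_left)
  also have "\<dots> = (\<Sum>i\<in>UNIV. \<Sum>a\<in>UNIV. \<Sum>j\<in>UNIV.
      ?G $ i $ j * g p (curvature D (X a) (E i) (E j) p) (X a p) / \<eta> a)"
    by (intro sum.cong refl sum.swap)
  also have "\<dots> = (\<Sum>a\<in>UNIV. (\<Sum>i\<in>UNIV. \<Sum>j\<in>UNIV.
      ?G $ i $ j * g p (curvature D (X a) (E i) (E j) p) (X a p)) / \<eta> a)"
    by (subst sum.swap) (simp add: sum_divide_distrib)
  also have "\<dots> = (\<Sum>a\<in>UNIV. (\<Sum>b\<in>UNIV. g p (curvature D (X a) (X b) (X b) p) (X a p) / \<eta> b) / \<eta> a)"
    by (subst metric_trace_eq[OF assms])
      (auto intro!: tensorial_imp_tensorial_at1 tensorial_curvature2 tensorial_curvature3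
        vector_field_tangent frame_field)
  finally show ?thesis
    by (simp add: sectional_curvature_frame sum_divide_distrib mult_ac)
qed

end

section \<open>The four-dimensional family\<close>

lemma vector_4:
  "(vector [a, b, c, d] :: 'a::zero ^ 4) $ 1 = a"
  "(vector [a, b, c, d] :: 'a::zero ^ 4) $ 2 = b"
  "(vector [a, b, c, d] :: 'a::zero ^ 4) $ 3 = c"
  "(vector [a, b, c, d] :: 'a::zero ^ 4) $ 4 = d"
  by (simp_all add: vector_def)

section \<open>Tables for the metric, the bracket and the three structures, with the resulting
  quadratic forms\<close>

definition eta4 :: "4 \<Rightarrow> real"
  where "eta4 i = vector [1, 1, -1, -1] $ i"

definition structure_constants :: "real \<Rightarrow> real \<Rightarrow> real \<Rightarrow> real \<Rightarrow> real ^ 4 ^ 4 ^ 4"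
  where "structure_constants l1 l2 l3 l4 = vector [
    vector [0, vector [0, 0, l2, - l1], vector [0, l2, 0, l4], vector [0, - l1, - l4, 0]],
    vector [vector [0, 0, - l2, l1], 0, vector [- l2, 0, 0, - l3], vector [l1, 0, l3, 0]],
    vector [vector [0, - l2, 0, - l4], vector [l2, 0, 0, l3], 0, vector [- l4, l3, 0, 0]],
    vector [vector [0, l1, l4, 0], vector [- l1, 0, - l3, 0], vector [l4, - l3, 0, 0], 0]]"

definition J1_matrix :: "real ^ 4 ^ 4"
  where "J1_matrix = vector [vector [0, -1, 0, 0], vector [1, 0, 0, 0],
    vector [0, 0, 0, 1], vector [0, 0, -1, 0]]"

definition J2_matrix :: "real ^ 4 ^ 4"
  where "J2_matrix = vector [vector [0, 0, -1, 0], vector [0, 0, 0, -1],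
    vector [1, 0, 0, 0], vector [0, 1, 0, 0]]"

text \<open>The product of the two preceding matrices: \<open>X1, X2, X3, X4\<close> go to
  \<open>-X4, X3, -X2, X1\<close>.\<close>

definition J3_matrix :: "real ^ 4 ^ 4"
  where "J3_matrix = vector [vector [0, 0, 0, 1], vector [0, 0, -1, 0],
    vector [0, 1, 0, 0], vector [-1, 0, 0, 0]]"

text \<open>The right-hand side of \<open>nabla_norm_sq_eq\<close> for the signature
  \<open>eta4\<close>, isolated as a finite expression in numbers only.\<close>

definition nabla_norm_form :: "real ^ 4 ^ 4 \<Rightarrow> real ^ 4 ^ 4 ^ 4 \<Rightarrow> real"
  where "nabla_norm_form M C = (\<Sum>k\<in>UNIV. \<Sum>i\<in>UNIV. \<Sum>a\<in>UNIV. eta4 a *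
    ((\<Sum>j\<in>UNIV. M $ j $ k * C $ i $ j $ a) - (\<Sum>b\<in>UNIV. M $ a $ b * C $ i $ k $ b))\<^sup>2
      / (4 * eta4 i * eta4 k))"

text \<open>Direct evaluation. All three values are nonzero multiples of the same \<open>q\<close>,
  so one vanishes exactly when the others do.\<close>

lemma nabla_norm_form_J:
  fixes l1 l2 l3 l4 :: real
  defines "C \<equiv> structure_constants l1 l2 l3 l4" and "q \<equiv> l1\<^sup>2 + l2\<^sup>2 - l3\<^sup>2 - l4\<^sup>2"
  shows "nabla_norm_form J1_matrix C = - 2 * q"
    and "nabla_norm_form J2_matrix C = 4 * q"
    and "nabla_norm_form J3_matrix C = 4 * q"
  unfolding nabla_norm_form_def C_def q_def
  by (simp_all add: sum_4 eta4_def structure_constants_def J1_matrix_def J2_matrix_def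
      J3_matrix_def vector_4)

lemma scalar_curvature_form:
  fixes l1 l2 l3 l4 :: real
  defines "C \<equiv> structure_constants l1 l2 l3 l4"
  shows "(\<Sum>a\<in>UNIV. \<Sum>b\<in>UNIV. \<Sum>j\<in>UNIV. eta4 j * (C $ a $ b $ j)\<^sup>2 / (4 * eta4 a * eta4 b))
    = - 3 / 2 * (l1\<^sup>2 + l2\<^sup>2 - l3\<^sup>2 - l4\<^sup>2)"
  unfolding C_def by (simp add: sum_4 eta4_def structure_constants_def vector_4 field_simps)

theorem proposition3p4:
  fixes G :: "'g::{t2_space, second_countable_topology} monoid"
    and A :: "('g, 4) chart set"
    and X :: "4 \<Rightarrow> 'g vfield"
    and l1 l2 l3 l4 :: real
    and g :: "'g tensor2"
    and J :: "3 \<Rightarrow> 'g endofield"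
    and D :: "'g connection"
  assumes "lie_group G A"
    and "connected (UNIV :: 'g set)"
    and "\<And>i. X i \<in> vector_fields A"
    and "\<And>i. left_invariant_field G (X i)"
    and "\<And>p. tangent_basis A p (\<lambda>i. X i p)"
    and "lie_bracket (X 1) (X 3) = (\<lambda>p f. l2 * X 2 p f + l4 * X 4 p f)"
    and "lie_bracket (X 2) (X 4) = (\<lambda>p f. l1 * X 1 p f + l3 * X 3 p f)"
    and "lie_bracket (X 2) (X 3) = (\<lambda>p f. - l2 * X 1 p f - l3 * X 4 p f)"
    and "lie_bracket (X 3) (X 4) = (\<lambda>p f. - l4 * X 1 p f + l3 * X 2 p f)"
    and "lie_bracket (X 4) (X 1) = (\<lambda>p f. l1 * X 2 p f + l4 * X 3 p f)"
    and "lie_bracket (X 2) (X 1) = (\<lambda>p f. - l2 * X 3 p f + l1 * X 4 p f)"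
    and "(l1, l2, l3, l4) \<noteq> (0, 0, 0, 0)"
    and "pseudo_riemannian_metric A g"
    and "left_invariant_tensor2 G A g"
    and "\<And>p. g p (X 1 p) (X 1 p) = 1"
    and "\<And>p. g p (X 2 p) (X 2 p) = 1"
    and "\<And>p. g p (X 3 p) (X 3 p) = - 1"
    and "\<And>p. g p (X 4 p) (X 4 p) = - 1"
    and "\<And>p i j. i \<noteq> j \<Longrightarrow> g p (X i p) (X j p) = 0"
    and "\<And>\<alpha>. almost_complex_structure A (J \<alpha>)"
    and "\<And>\<alpha>. left_invariant_endofield G A (J \<alpha>)"
    and "\<And>p. J 1 p (X 1 p) = X 2 p"
    and "\<And>p. J 1 p (X 2 p) = (\<lambda>f. - X 1 p f)"
    and "\<And>p. J 1 p (X 3 p) = (\<lambda>f. - X 4 p f)"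
    and "\<And>p. J 1 p (X 4 p) = X 3 p"
    and "\<And>p. J 2 p (X 1 p) = X 3 p"
    and "\<And>p. J 2 p (X 2 p) = X 4 p"
    and "\<And>p. J 2 p (X 3 p) = (\<lambda>f. - X 1 p f)"
    and "\<And>p. J 2 p (X 4 p) = (\<lambda>f. - X 2 p f)"
    and "\<And>p v. v \<in> tangent_space A p \<Longrightarrow> J 3 p v = J 1 p (J 2 p v)"
    and "levi_civita_connection A g D"
  shows "((\<exists>\<alpha>. isotropic_kaehlerian A g D (J \<alpha>)) \<longrightarrow> isotropic_hyper_kaehlerian A g D J)
    \<and> (isotropic_hyper_kaehlerian A g D J \<longleftrightarrow> l1\<^sup>2 + l2\<^sup>2 - l3\<^sup>2 - l4\<^sup>2 = 0)
    \<and> (isotropic_hyper_kaehlerian A g D J \<longleftrightarrow> zero_scalar_curvature A g D)"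
proof -
  define C where "C = structure_constants l1 l2 l3 l4"
  define q where "q = l1\<^sup>2 + l2\<^sup>2 - l3\<^sup>2 - l4\<^sup>2"
  note X = assms(3) and brackets = assms(6-11)
  \<comment> \<open>The hypotheses give each bracket in one order only; antisymmetry supplies the
    other order and the diagonal.\<close>
  have bracket_flip: "lie_bracket (X j) (X i) = (\<lambda>p f. - lie_bracket (X i) (X j) p f)" for i j
    by (simp add: lie_bracket_def)
  have bracket_self: "lie_bracket (X i) (X i) = (\<lambda>p f. 0)" for i
    by (simp add: lie_bracket_def)
  interpret invariant_frame A g X eta4 D C
  proof unfold_locales
    show "smooth_atlas A"
      using assms(1) by (simp add: lie_group_def)
    show "pseudo_riemannian_metric A g" "levi_civita_connection A g D"
      by fact+
    show "X i \<in> vector_fields A" "tangent_basis A p (\<lambda>i. X i p)" for i p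
      by fact+
    have "\<forall>i. g p (X i p) (X i p) = eta4 i" for p
      using assms(15-18) by (simp add: forall_4 eta4_def vector_4)
    then show "g p (X i p) (X j p) = (if i = j then eta4 i else 0)" for p i j
      using assms(19) by simp
    have "\<forall>i. eta4 i \<noteq> 0"
      by (simp add: forall_4 eta4_def vector_4)
    then show "eta4 i \<noteq> 0" for i
      by simp
    have "\<forall>i j k. C $ j $ i $ k = - C $ i $ j $ k"
      by (simp add: forall_4 C_def structure_constants_def vector_4)
    then show "C $ j $ i $ k = - C $ i $ j $ k" for i j k
      by blast
    \<comment> \<open>Invariance of the metric is verified on the table of structure
      constants.\<close>
    have "\<forall>i j k. C $ i $ k $ j * eta4 j = - (C $ i $ j $ k * eta4 k)"
      by (simp add: forall_4 C_def structure_constants_def eta4_def vector_4)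
    then show "C $ i $ k $ j * eta4 j = - (C $ i $ j $ k * eta4 k)" for i j k
      by blast
    have "\<forall>i j. lie_bracket (X i) (X j) = (\<lambda>p f. \<Sum>k\<in>UNIV. C $ i $ j $ k * X k p f)"
      using bracket_flip[of 1 2] bracket_flip[of 3 1] bracket_flip[of 1 4]
        bracket_flip[of 3 2] bracket_flip[of 4 2] bracket_flip[of 4 3] brackets
      by (simp add: forall_4 bracket_self sum_4 C_def structure_constants_def vector_4 add.commute)
    then show "lie_bracket (X i) (X j) = (\<lambda>p f. \<Sum>k\<in>UNIV. C $ i $ j $ k * X k p f)" for i j
      by blast
  qed
  have norm: "nabla_norm_sq g D (J \<alpha>) E p = nabla_norm_form M C"
    if "\<And>p. \<forall>j. J \<alpha> p (X j p) = (\<lambda>f. \<Sum>a\<in>UNIV. M $ a $ j * X a p f)" "basis_fields A p E"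
    for \<alpha> M E p
  proof -
    interpret almost_complex_frame A g X eta4 D C "J \<alpha>" M
      using assms(20) that(1) by unfold_locales auto
    show ?thesis
      using nabla_norm_sq_eq[OF that(2)] by (simp add: nabla_norm_form_def)
  qed
  \<comment> \<open>Used for \<open>J 3 = J 1 J 2\<close> on \<open>X 3\<close> and
    \<open>X 4\<close>, whose images under \<open>J 2\<close> are negatives of frame fields.\<close>
  have neg: "J 1 p (\<lambda>f. - X i p f) = (\<lambda>f. - J 1 p (X i p) f)" for i p
  proof -
    have "J 1 p (\<lambda>f. (-1) * X i p f) = (\<lambda>f. (-1) * J 1 p (X i p) f)"
      using assms(20)[of 1] vector_field_tangent[OF X] unfolding almost_complex_structure_def by blast
    then show ?thesis
      by simp
  qed
  have J1: "\<forall>j. J 1 p (X j p) = (\<lambda>f. \<Sum>a\<in>UNIV. J1_matrix $ a $ j * X a p f)" for p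
    using assms(22-25) by (simp add: forall_4 sum_4 J1_matrix_def vector_4)
  have J2: "\<forall>j. J 2 p (X j p) = (\<lambda>f. \<Sum>a\<in>UNIV. J2_matrix $ a $ j * X a p f)" for p
    using assms(26-29) by (simp add: forall_4 sum_4 J2_matrix_def vector_4)
  have J3: "\<forall>j. J 3 p (X j p) = (\<lambda>f. \<Sum>a\<in>UNIV. J3_matrix $ a $ j * X a p f)" for p
    using assms(22-29)
    by (simp add: forall_4 sum_4 J3_matrix_def vector_4 assms(30) vector_field_tangent[OF X] neg)
  \<comment> \<open>The definitions quantify over all bases at \<open>p\<close>. The frame shows
    that one exists, so isotropy and zero scalar curvature do force \<open>q = 0\<close>.\<close>
  have frame: "basis_fields A p X" for p
    using X assms(5) by (simp add: basis_fields_def)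
  have "isotropic_kaehlerian A g D (J 1) \<longleftrightarrow> q = 0"
    "isotropic_kaehlerian A g D (J 2) \<longleftrightarrow> q = 0"
    "isotropic_kaehlerian A g D (J 3) \<longleftrightarrow> q = 0"
    using frame norm[OF J1] norm[OF J2] norm[OF J3]
    by (auto simp: isotropic_kaehlerian_def C_def q_def nabla_norm_form_J)
  then have isotropic: "\<forall>\<alpha>. isotropic_kaehlerian A g D (J \<alpha>) \<longleftrightarrow> q = 0"
    by (simp add: forall_3)
  have "scalar_curvature g D E p = - 3 / 2 * q" if "basis_fields A p E" for E :: "4 \<Rightarrow> 'g vfield" and p
    using scalar_curvature_eq[OF that] scalar_curvature_form unfolding C_def q_def by simp
  then have "zero_scalar_curvature A g D \<longleftrightarrow> q = 0"
    using frame unfolding zero_scalar_curvature_def by auto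
  then show ?thesis
    using isotropic unfolding isotropic_hyper_kaehlerian_def q_def by blast
qed

end
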